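(* For any large enough $n$ and $\varepsilon=\Omega(1/n)$, there exist $b\in\mathbb{R}^n$ and $t\in[n]$ such that the following holds. Every randomized algorithm that, given access to an invertible SDD matrix $S\in\mathbb{R}^{n\times n}$ whose spectral gap is $\Omega(1)$, succeeds with probability at least $3/4$ to approximate $x^{\ast}(t)$ within absolute error $\varepsilon\|x^{\ast}\|_\infty$, where $x^{\ast}=S^{-1}b$, must probe $\Omega(1/\varepsilon)$ coordinates of $S$ in the worst case.
   Context: A matrix $S$ is SDD if it is symmetric, has positive diagonal, and $S(j,j)\ge\sum_{k\ne j}|S(j,k)|$ for all $j$. Its spectral gap is half the smallest nonzero eigenvalue of $D_S^{-1/2}SD_S^{-1/2}$, where $D_S$ is the diagonal part of $S$.
   Formalization: The formal statement adds the condition ε < 1; for ε ≥ 1 the claim fails, since the constant output 0 is within ε‖x*‖∞ of x*(t) with no probes. *)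

theory Defs
  imports
    "HOL-Probability.Probability_Measure"
    "Jordan_Normal_Form.Gauss_Jordan_Elimination"
    "Jordan_Normal_Form.Spectral_Radius"
begin

definition SDD :: "real mat \<Rightarrow> bool" where
  "SDD S \<longleftrightarrow> square_mat S \<and> transpose_mat S = S \<and>
     (\<forall>j<dim_row S. S $$ (j, j) > 0) \<and>
     (\<forall>j<dim_row S. S $$ (j, j) \<ge> (\<Sum>k\<in>{..<dim_row S} - {j}. \<bar>S $$ (j, k)\<bar>))"

definition normalized_mat :: "real mat \<Rightarrow> real mat" where
  "normalized_mat S =
     (let D = mat_diag (dim_row S) (\<lambda>i. 1 / sqrt (S $$ (i, i))) in D * S * D)"

definition spectral_gap :: "real mat \<Rightarrow> real" where
  "spectral_gap S = Min (spectrum (normalized_mat S) - {0}) / 2"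

definition sdd_inputs :: "nat \<Rightarrow> real \<Rightarrow> real mat set" where
  "sdd_inputs n \<gamma> =
     {S \<in> carrier_mat n n. SDD S \<and> invertible_mat S \<and> spectral_gap S \<ge> \<gamma>}"

definition linear_solution :: "real mat \<Rightarrow> real vec \<Rightarrow> real vec" where
  "linear_solution S b = the (mat_inverse S) *\<^sub>v b"

definition linf_norm :: "real vec \<Rightarrow> real" where
  "linf_norm x = Max ((\<lambda>i. \<bar>vec_index x i\<bar>) ` {..<dim_vec x})"

text \<open>A deterministic adaptive algorithm is a decision tree: a probe of entry \<open>(i, j)\<close>
  continues with the subtree selected by the value read. Computation between probes is free.\<close>

datatype probe_tree = Output real | Probe nat nat "real \<Rightarrow> probe_tree"

primrec tree_output :: "real mat \<Rightarrow> probe_tree \<Rightarrow> real" where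
  "tree_output S (Output r) = r"
| "tree_output S (Probe i j f) = tree_output S (f (S $$ (i, j)))"

primrec probed :: "real mat \<Rightarrow> probe_tree \<Rightarrow> (nat \<times> nat) set" where
  "probed S (Output r) = {}"
| "probed S (Probe i j f) = insert (i, j) (probed S (f (S $$ (i, j))))"

text \<open>A randomized algorithm is a probability distribution over deterministic ones. The
  \<open>\<sigma>\<close>-algebra is arbitrary, as long as the output and the number of probed coordinates are
  random variables on every input; so any source of randomness is covered, by push-forward.\<close>

definition randomized_algorithm :: "nat \<Rightarrow> probe_tree measure \<Rightarrow> bool" where
  "randomized_algorithm n R \<longleftrightarrow> prob_space R \<and>
     (\<forall>S\<in>carrier_mat n n.
        (\<forall>T\<in>space R. probed S T \<subseteq> {..<n} \<times> {..<n}) \<and>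
        (\<lambda>T. tree_output S T) \<in> borel_measurable R \<and>
        (\<lambda>T. card (probed S T)) \<in> measurable R (count_space UNIV))"

end

theory Submission
  imports Defs
begin

text \<open>Let \<open>S\<close> be diagonal except for entries \<open>\<plusminus>a\<close> that link the coordinate \<open>t\<close> to a single hidden
  coordinate \<open>k\<close>, with \<open>S(t,t) = a < 1\<close> and all other diagonal entries \<open>1\<close>. After normalization the
  link has modulus \<open>\<surd>a\<close>, which bounds the spectral gap away from \<open>0\<close>. For \<open>b\<close> vanishing at \<open>t\<close> and
  equal to \<open>1\<close> elsewhere, \<open>x = S\<^sup>-\<^sup>1 b\<close> satisfies \<open>x(t) = \<mp>\<parallel>x\<parallel>\<^sub>\<infinity>\<close>; hence for every \<open>\<epsilon> < 1\<close> an accurate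
  output reveals the sign of the link. A decision tree that is accurate for both signs at \<open>k\<close> must
  therefore probe \<open>(t,k)\<close> or \<open>(k,t)\<close> when it is run on the diagonal matrix. An algorithm that is
  accurate on each input with probability at least \<open>p\<close> is accurate for both signs at \<open>k\<close> with
  probability at least \<open>2p - 1\<close>, so on the diagonal matrix it makes at least \<open>(2p - 1)(n - 1)\<close> probes
  in expectation, and \<open>n\<close> is at least of order \<open>1/\<epsilon>\<close>.\<close>

unbundle no vec_syntax

section \<open>Probability spaces\<close>

lemma (in prob_space) prob_Int_ge:
  assumes "A \<in> events" "B \<in> events"
  shows "prob A + prob B - 1 \<le> prob (A \<inter> B)"
proof -
  have "prob (A \<union> B) = prob A + prob B - prob (A \<inter> B)"
    using assms by (simp add: measure_Un3 fmeasurable_eq_sets)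
  then show ?thesis using prob_le_1[of "A \<union> B"] by linarith
qed

lemma (in prob_space) sum_prob_eq_expectation_card:
  assumes "finite K" and events: "\<And>k. k \<in> K \<Longrightarrow> A k \<in> events"
  shows "(\<Sum>k\<in>K. prob (A k)) = expectation (\<lambda>x. real (card {k \<in> K. x \<in> A k}))"
proof -
  have "integrable M (indicat_real (A k))" if "k \<in> K" for k
    using events[OF that] by (simp add: integrable_indicator_iff emeasure_eq_measure)
  then have "expectation (\<lambda>x. \<Sum>k\<in>K. indicat_real (A k) x)
      = (\<Sum>k\<in>K. expectation (indicat_real (A k)))"
    by (rule Bochner_Integration.integral_sum)
  also have "\<dots> = (\<Sum>k\<in>K. prob (A k))"
    using events by (intro sum.cong) auto
  finally show ?thesis
    using \<open>finite K\<close> by (simp add: indicator_def sum.If_cases Int_def)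
qed

lemma (in prob_space) prob_ge_pos_if_expectation_ge:
  fixes X :: "'a \<Rightarrow> real"
  assumes "integrable M X" and "q \<le> expectation X"
  shows "0 < prob {x \<in> space M. q \<le> X x}"
proof (rule ccontr)
  have [measurable]: "X \<in> borel_measurable M"
    using assms(1) by simp
  assume "\<not> ?thesis"
  then have "prob {x \<in> space M. q \<le> X x} = 0"
    using measure_nonneg[of M "{x \<in> space M. q \<le> X x}"] by linarith
  then have "{x \<in> space M. q \<le> X x} \<in> null_sets M"
    by (simp add: emeasure_eq_measure null_setsI)
  then have "AE x in M. X x < q"
    using AE_not_in AE_space[of M] by (fastforce elim: eventually_elim2)
  then show False
    using expectation_less[OF assms(1)] assms(2) by fastforce
qed

section \<open>Decision trees\<close>

lemma finite_probed: "finite (probed S T)"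
  by (induction T) auto

lemma tree_output_cong:
  assumes "\<And>i j. (i, j) \<in> probed S T \<Longrightarrow> S' $$ (i, j) = S $$ (i, j)"
  shows "tree_output S' T = tree_output S T"
  using assms by (induction T) auto

lemma integrable_card_probed:
  assumes alg: "randomized_algorithm n R" and "S \<in> carrier_mat n n"
  shows "integrable R (\<lambda>T. real (card (probed S T)))"
proof -
  interpret prob_space R
    using alg by (simp add: randomized_algorithm_def)
  have "(\<lambda>T. card (probed S T)) \<in> measurable R (count_space UNIV)"
    using assms by (auto simp: randomized_algorithm_def)
  then have "(\<lambda>T. real (card (probed S T))) \<in> borel_measurable R"
    by measurable
  moreover have "card (probed S T) \<le> card ({..<n} \<times> {..<n})" if "T \<in> space R" for T
    using assms that by (intro card_mono) (auto simp: randomized_algorithm_def)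
  then have "AE T in R. norm (real (card (probed S T))) \<le> real (card ({..<n} \<times> {..<n}))"
    by (intro AE_I2) (simp only: real_norm_def abs_of_nat of_nat_le_iff)
  ultimately show ?thesis
    by (intro integrable_const_bound)
qed

lemma card_hit_le_card:
  assumes "finite P" and "disjoint_family_on B K"
  shows "card {k \<in> K. B k \<inter> P \<noteq> {}} \<le> card P"
proof -
  define f where "f k = (SOME x. x \<in> B k \<inter> P)" for k
  have f: "f k \<in> B k \<inter> P" if "B k \<inter> P \<noteq> {}" for k
    unfolding f_def some_in_eq using that .
  have "inj_on f {k \<in> K. B k \<inter> P \<noteq> {}}"
  proof (rule inj_onI)
    fix k l assume "k \<in> {k \<in> K. B k \<inter> P \<noteq> {}}" "l \<in> {k \<in> K. B k \<inter> P \<noteq> {}}" "f k = f l"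
    then have "k \<in> K" "l \<in> K" "f k \<in> B k \<inter> B l"
      using f[of k] f[of l] by auto
    then show "k = l"
      using disjoint_family_onD[OF assms(2)] by blast
  qed
  then show ?thesis
    using f assms(1) by (intro card_inj_on_le[of f]) auto
qed

locale hidden_blocks =
  fixes n :: nat and base :: "real mat" and K :: "'k set" and block :: "'k \<Rightarrow> (nat \<times> nat) set"
    and variant :: "'k \<Rightarrow> bool \<Rightarrow> real mat" and target :: "'k \<Rightarrow> bool \<Rightarrow> real set"
  assumes finite_index: "finite K"
    and disjoint_blocks: "disjoint_family_on block K"
    and base_carrier: "base \<in> carrier_mat n n"
    and variant_carrier: "k \<in> K \<Longrightarrow> variant k s \<in> carrier_mat n n"
    and variant_agrees: "\<lbrakk>k \<in> K; i < n; j < n; (i, j) \<notin> block k\<rbrakk>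
      \<Longrightarrow> variant k s $$ (i, j) = base $$ (i, j)"
    and target_borel: "k \<in> K \<Longrightarrow> target k s \<in> sets borel"
    and disjoint_targets: "k \<in> K \<Longrightarrow> target k True \<inter> target k False = {}"
begin

lemma card_hit_targets_le_card_probed:
  assumes "probed base T \<subseteq> {..<n} \<times> {..<n}"
  shows "card {k \<in> K. \<forall>s. tree_output (variant k s) T \<in> target k s} \<le> card (probed base T)"
proof -
  have "block k \<inter> probed base T \<noteq> {}"
    if k: "k \<in> K" and hits: "\<forall>s. tree_output (variant k s) T \<in> target k s" for k
  proof
    assume missed: "block k \<inter> probed base T = {}"
    have "tree_output (variant k s) T = tree_output base T" for s
      using assms missed by (intro tree_output_cong variant_agrees[OF k]) auto
    then have "tree_output base T \<in> target k True \<inter> target k False"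
      using hits by (metis IntI)
    then show False
      using disjoint_targets[OF k] by blast
  qed
  then have "card {k \<in> K. \<forall>s. tree_output (variant k s) T \<in> target k s}
      \<le> card {k \<in> K. block k \<inter> probed base T \<noteq> {}}"
    using finite_index by (intro card_mono) auto
  also have "\<dots> \<le> card (probed base T)"
    using finite_probed disjoint_blocks by (rule card_hit_le_card)
  finally show ?thesis .
qed

text \<open>Probing a given block need not be an event of \<open>R\<close>, only hitting a target is; hence the detour
  through the number of indices whose two targets are both hit.\<close>

lemma expected_probes_ge:
  assumes alg: "randomized_algorithm n R"
    and success: "\<And>k s. k \<in> K \<Longrightarrow>
      p \<le> measure R {T \<in> space R. tree_output (variant k s) T \<in> target k s}"
  shows "(2 * p - 1) * real (card K) \<le> (\<integral>T. real (card (probed base T)) \<partial>R)"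
proof -
  interpret prob_space R
    using alg by (simp add: randomized_algorithm_def)
  define hit where "hit k s = {T \<in> space R. tree_output (variant k s) T \<in> target k s}" for k s
  have hit_events: "hit k s \<in> events" if "k \<in> K" for k s
  proof -
    have "(\<lambda>T. tree_output (variant k s) T) \<in> borel_measurable R"
      using alg variant_carrier[OF that] by (auto simp: randomized_algorithm_def)
    then show ?thesis
      using measurable_sets[OF _ target_borel[OF that]]
      by (simp add: hit_def vimage_def Int_def conj_commute)
  qed
  have "2 * p - 1 \<le> prob (hit k True \<inter> hit k False)" if "k \<in> K" for k
    using prob_Int_ge[OF hit_events hit_events, OF that that, of True False]
      success[OF that, of True] success[OF that, of False] by (simp add: hit_def)
  then have "(2 * p - 1) * real (card K) \<le> (\<Sum>k\<in>K. prob (hit k True \<inter> hit k False))"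
    using sum_bounded_below[of K "2 * p - 1"] by (simp add: mult.commute)
  also have "\<dots> = expectation (\<lambda>T. real (card {k \<in> K. T \<in> hit k True \<inter> hit k False}))"
    using finite_index hit_events by (intro sum_prob_eq_expectation_card sets.Int)
  also have "\<dots> \<le> expectation (\<lambda>T. real (card (probed base T)))"
  proof (rule integral_mono')
    fix T assume "T \<in> space R"
    then have "{k \<in> K. T \<in> hit k True \<inter> hit k False}
        = {k \<in> K. \<forall>s. tree_output (variant k s) T \<in> target k s}"
      by (auto simp: hit_def all_bool_eq)
    moreover have "probed base T \<subseteq> {..<n} \<times> {..<n}"
      using alg base_carrier \<open>T \<in> space R\<close> by (auto simp: randomized_algorithm_def)
    ultimately show "real (card {k \<in> K. T \<in> hit k True \<inter> hit k False})
        \<le> real (card (probed base T))"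
      using card_hit_targets_le_card_probed by simp
  qed (simp_all add: integrable_card_probed[OF alg base_carrier])
  finally show ?thesis .
qed

end

section \<open>Linear systems\<close>

lemma invertible_mat_iff_Units:
  assumes S: "S \<in> carrier_mat n n"
  shows "invertible_mat S \<longleftrightarrow> S \<in> Units (ring_mat TYPE('a :: field) n b)"
proof
  assume "invertible_mat S"
  then obtain B where "inverts_mat S B" "inverts_mat B S"
    unfolding invertible_mat_def by blast
  then have SB: "S * B = 1\<^sub>m n" and BS: "B * S = 1\<^sub>m (dim_row B)"
    using S by (auto simp: inverts_mat_def)
  have "dim_col B = n" "dim_row B = n"
    using arg_cong[OF SB, of dim_col] arg_cong[OF BS, of dim_col] S by auto
  then show "S \<in> Units (ring_mat TYPE('a) n b)"
    using S SB BS by (auto simp: Units_def ring_mat_def)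
qed (auto simp: Units_def ring_mat_def invertible_mat_def inverts_mat_def)

lemma invertible_mat_if_kernel_trivial:
  fixes S :: "'a :: field mat"
  assumes S: "S \<in> carrier_mat n n"
    and "\<And>v. \<lbrakk>v \<in> carrier_vec n; S *\<^sub>v v = 0\<^sub>v n\<rbrakk> \<Longrightarrow> v = 0\<^sub>v n"
  shows "invertible_mat S"
proof -
  have "det S \<noteq> 0"
    using assms det_0_iff_vec_prod_zero[OF S] by blast
  then show ?thesis
    using det_non_zero_imp_unit[OF S] invertible_mat_iff_Units[OF S, where b = "()"] by simp
qed

lemma linear_solution_eqI:
  assumes S: "S \<in> carrier_mat n n" "invertible_mat S"
    and x: "x \<in> carrier_vec n" "S *\<^sub>v x = b"
  shows "linear_solution S b = x"
proof -
  have "S \<in> Units (ring_mat TYPE(real) n ())"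
    using S invertible_mat_iff_Units[OF S(1), where b = "()"] by simp
  then obtain C where inverse: "mat_inverse S = Some C"
    using mat_inverse(1)[OF S(1), where b = "()"] by (cases "mat_inverse S") auto
  then have C: "C * S = 1\<^sub>m n" "C \<in> carrier_mat n n"
    using mat_inverse(2)[OF S(1)] by auto
  have "C *\<^sub>v b = (C * S) *\<^sub>v x"
    unfolding x(2)[symmetric] using C(2) S(1) x(1) by simp
  then show ?thesis
    using C(1) x(1) by (simp add: linear_solution_def inverse)
qed

definition accurate_outputs :: "real \<Rightarrow> real mat \<Rightarrow> real vec \<Rightarrow> nat \<Rightarrow> real set" where
  "accurate_outputs \<epsilon> S b t =
     {y. \<bar>y - linear_solution S b $ t\<bar> \<le> \<epsilon> * linf_norm (linear_solution S b)}"

lemma accurate_outputs_borel: "accurate_outputs \<epsilon> S b t \<in> sets borel"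
  by (simp add: accurate_outputs_def)

section \<open>Arrowhead matrices\<close>

definition arrowhead_mat :: "nat \<Rightarrow> nat \<Rightarrow> real \<Rightarrow> (nat \<Rightarrow> real) \<Rightarrow> real mat" where
  "arrowhead_mat n t a w = mat n n (\<lambda>(i, j).
     if i = j then (if i = t then a else 1)
     else if i = t then w j else if j = t then w i else 0)"

lemma arrowhead_mat_carrier [simp]:
  "arrowhead_mat n t a w \<in> carrier_mat n n"
  "dim_row (arrowhead_mat n t a w) = n" "dim_col (arrowhead_mat n t a w) = n"
  by (simp_all add: arrowhead_mat_def)

lemma arrowhead_mat_index:
  "\<lbrakk>i < n; j < n\<rbrakk> \<Longrightarrow> arrowhead_mat n t a w $$ (i, j) =
     (if i = j then (if i = t then a else 1)
      else if i = t then w j else if j = t then w i else 0)"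
  by (simp add: arrowhead_mat_def)

lemma arrowhead_mat_mult_vec:
  assumes "t < n" and "v \<in> carrier_vec n" and "i < n"
  shows "(arrowhead_mat n t a w *\<^sub>v v) $ i =
    (if i = t then a * v $ t + (\<Sum>j\<in>{..<n} - {t}. w j * v $ j) else w i * v $ t + v $ i)"
proof -
  have row: "(arrowhead_mat n t a w *\<^sub>v v) $ i = (\<Sum>j<n. arrowhead_mat n t a w $$ (i, j) * v $ j)"
    using assms by (simp add: scalar_prod_def atLeast0LessThan)
  show ?thesis
  proof (cases "i = t")
    case True
    then show ?thesis
      unfolding row using assms by (subst sum.remove[of _ t]) (auto simp: arrowhead_mat_index)
  next
    case False
    have "(\<Sum>j<n. arrowhead_mat n t a w $$ (i, j) * v $ j)
        = (\<Sum>j\<in>{t, i}. arrowhead_mat n t a w $$ (i, j) * v $ j)"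
      using assms by (intro sum.mono_neutral_right) (auto simp: arrowhead_mat_index False)
    then show ?thesis
      unfolding row using assms False by (simp add: arrowhead_mat_index)
  qed
qed

text \<open>Block elimination: the Schur complement of the unit block is \<open>a - \<Sum> w\<^sup>2\<close>.\<close>

lemma arrowhead_mat_mult_vec_eq_iff:
  assumes "t < n" and "v \<in> carrier_vec n" and b: "b \<in> carrier_vec n"
  shows "arrowhead_mat n t a w *\<^sub>v v = b \<longleftrightarrow>
    (a - (\<Sum>j\<in>{..<n} - {t}. (w j)\<^sup>2)) * v $ t = b $ t - (\<Sum>j\<in>{..<n} - {t}. w j * b $ j) \<and>
    (\<forall>j\<in>{..<n} - {t}. v $ j = b $ j - w j * v $ t)"
proof -
  have spoke_sum: "(\<Sum>j\<in>{..<n} - {t}. w j * v $ j)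
      = (\<Sum>j\<in>{..<n} - {t}. w j * b $ j) - (\<Sum>j\<in>{..<n} - {t}. (w j)\<^sup>2) * v $ t"
    if "\<forall>j\<in>{..<n} - {t}. v $ j = b $ j - w j * v $ t"
  proof -
    have "(\<Sum>j\<in>{..<n} - {t}. w j * v $ j) = (\<Sum>j\<in>{..<n} - {t}. w j * b $ j - (w j)\<^sup>2 * v $ t)"
      using that by (intro sum.cong) (simp_all add: right_diff_distrib power2_eq_square mult.assoc)
    then show ?thesis
      by (simp add: sum_subtractf sum_distrib_right)
  qed
  have "arrowhead_mat n t a w *\<^sub>v v = b \<longleftrightarrow> (\<forall>i<n. (arrowhead_mat n t a w *\<^sub>v v) $ i = b $ i)"
    using b by (auto intro: eq_vecI simp del: index_mult_mat_vec)
  also have "\<dots> \<longleftrightarrow> (arrowhead_mat n t a w *\<^sub>v v) $ t = b $ t \<and>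
      (\<forall>i\<in>{..<n} - {t}. (arrowhead_mat n t a w *\<^sub>v v) $ i = b $ i)"
    using \<open>t < n\<close> by blast
  also have "\<dots> \<longleftrightarrow> a * v $ t + (\<Sum>j\<in>{..<n} - {t}. w j * v $ j) = b $ t \<and>
      (\<forall>j\<in>{..<n} - {t}. v $ j = b $ j - w j * v $ t)"
    using assms by (auto simp: arrowhead_mat_mult_vec algebra_simps simp del: index_mult_mat_vec)
  also have "\<dots> \<longleftrightarrow>
      (a - (\<Sum>j\<in>{..<n} - {t}. (w j)\<^sup>2)) * v $ t = b $ t - (\<Sum>j\<in>{..<n} - {t}. w j * b $ j) \<and>
      (\<forall>j\<in>{..<n} - {t}. v $ j = b $ j - w j * v $ t)"
    using spoke_sum by (auto simp: algebra_simps)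
  finally show ?thesis .
qed

lemma invertible_arrowhead_mat:
  assumes "t < n" and "a \<noteq> (\<Sum>j\<in>{..<n} - {t}. (w j)\<^sup>2)"
  shows "invertible_mat (arrowhead_mat n t a w)"
proof (rule invertible_mat_if_kernel_trivial)
  fix v :: "real vec"
  assume v: "v \<in> carrier_vec n" and "arrowhead_mat n t a w *\<^sub>v v = 0\<^sub>v n"
  then have "(a - (\<Sum>j\<in>{..<n} - {t}. (w j)\<^sup>2)) * v $ t = 0"
    and spokes: "\<forall>j\<in>{..<n} - {t}. v $ j = - w j * v $ t"
    using assms(1) by (simp_all add: arrowhead_mat_mult_vec_eq_iff)
  then have "v $ t = 0"
    using assms(2) by simp
  then show "v = 0\<^sub>v n"
    using spokes v by (intro eq_vecI) force+
qed simp

lemma linear_solution_arrowhead_mat: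
  fixes b :: "real vec"
  assumes "t < n" and "b \<in> carrier_vec n" and "a \<noteq> (\<Sum>j\<in>{..<n} - {t}. (w j)\<^sup>2)"
  defines "y \<equiv> (b $ t - (\<Sum>j\<in>{..<n} - {t}. w j * b $ j)) / (a - (\<Sum>j\<in>{..<n} - {t}. (w j)\<^sup>2))"
  shows "linear_solution (arrowhead_mat n t a w) b
    = vec n (\<lambda>j. if j = t then y else b $ j - w j * y)" (is "_ = ?x")
proof (rule linear_solution_eqI)
  show "arrowhead_mat n t a w *\<^sub>v ?x = b"
    using assms by (subst arrowhead_mat_mult_vec_eq_iff) (auto simp: y_def)
qed (use assms invertible_arrowhead_mat in auto)

lemma SDD_arrowhead_mat:
  assumes "t < n" and "0 < a" and "(\<Sum>j\<in>{..<n} - {t}. \<bar>w j\<bar>) \<le> a"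
    and "\<And>j. \<lbrakk>j < n; j \<noteq> t\<rbrakk> \<Longrightarrow> \<bar>w j\<bar> \<le> 1"
  shows "SDD (arrowhead_mat n t a w)"
proof -
  have "(\<Sum>k\<in>{..<n} - {j}. \<bar>arrowhead_mat n t a w $$ (j, k)\<bar>) \<le> arrowhead_mat n t a w $$ (j, j)"
    if "j < n" for j
  proof (cases "j = t")
    case True
    then show ?thesis
      using assms by (simp add: arrowhead_mat_index)
  next
    case False
    have "(\<Sum>k\<in>{..<n} - {j}. \<bar>arrowhead_mat n t a w $$ (j, k)\<bar>)
        = (\<Sum>k\<in>{t}. \<bar>arrowhead_mat n t a w $$ (j, k)\<bar>)"
      using False that \<open>t < n\<close> by (intro sum.mono_neutral_right) (auto simp: arrowhead_mat_index)
    then show ?thesis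
      using False that assms by (simp add: arrowhead_mat_index)
  qed
  moreover have "transpose_mat (arrowhead_mat n t a w) = arrowhead_mat n t a w"
    by (intro eq_matI) (auto simp: arrowhead_mat_index)
  ultimately show ?thesis
    using assms by (auto simp: SDD_def arrowhead_mat_index)
qed

lemma normalized_arrowhead_mat:
  assumes "0 < a"
  shows "normalized_mat (arrowhead_mat n t a w) = arrowhead_mat n t 1 (\<lambda>j. w j / sqrt a)"
proof -
  let ?A = "arrowhead_mat n t a w"
  let ?r = "\<lambda>i. 1 / sqrt (?A $$ (i, i))"
  have "mat_diag n ?r * ?A * mat_diag n ?r = mat n n (\<lambda>(i, j). ?r i * ?A $$ (i, j) * ?r j)"
    by (subst mat_diag_mult_left[of _ n n], simp, subst mat_diag_mult_right[of _ n n], simp) auto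
  also have "\<dots> = arrowhead_mat n t 1 (\<lambda>j. w j / sqrt a)"
    using assms by (intro eq_matI) (auto simp: arrowhead_mat_index)
  finally show ?thesis
    by (simp add: normalized_mat_def Let_def)
qed

lemma spectrum_arrowhead_mat_subset:
  fixes w :: "nat \<Rightarrow> real"
  assumes "t < n"
  defines "r \<equiv> L2_set w ({..<n} - {t})"
  shows "spectrum (arrowhead_mat n t 1 w) \<subseteq> {1, 1 - r, 1 + r}"
proof
  fix l assume "l \<in> spectrum (arrowhead_mat n t 1 w)"
  then obtain v where v: "v \<in> carrier_vec n" "v \<noteq> 0\<^sub>v n"
    and eigen: "arrowhead_mat n t 1 w *\<^sub>v v = l \<cdot>\<^sub>v v"
    by (auto simp: spectrum_def eigenvalue_def eigenvector_def)
  have entry: "(arrowhead_mat n t 1 w *\<^sub>v v) $ i = l * v $ i" if "i < n" for i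
    using v(1) that unfolding eigen by simp
  have hub: "(l - 1) * v $ t = (\<Sum>j\<in>{..<n} - {t}. w j * v $ j)"
    using entry[OF \<open>t < n\<close>] \<open>t < n\<close> v(1)
    by (simp add: arrowhead_mat_mult_vec algebra_simps del: index_mult_mat_vec)
  have spoke: "(l - 1) * v $ j = w j * v $ t" if "j \<in> {..<n} - {t}" for j
    using entry[of j] that \<open>t < n\<close> v(1)
    by (simp add: arrowhead_mat_mult_vec algebra_simps del: index_mult_mat_vec)
  have "(l - 1)\<^sup>2 * v $ t = (\<Sum>j\<in>{..<n} - {t}. w j * ((l - 1) * v $ j))"
    by (simp add: power2_eq_square mult.assoc hub sum_distrib_left mult.left_commute)
  also have "\<dots> = (\<Sum>j\<in>{..<n} - {t}. w j * (w j * v $ t))"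
    by (intro sum.cong refl) (simp only: spoke)
  also have "\<dots> = r\<^sup>2 * v $ t"
    by (simp add: r_def L2_set_def sum_nonneg sum_distrib_right power2_eq_square mult.assoc)
  finally have "l = 1 \<or> (l - 1)\<^sup>2 = r\<^sup>2"
  proof (cases "v $ t = 0")
    case True
    have "l = 1"
    proof (rule ccontr)
      assume "l \<noteq> 1"
      then have "v $ i = 0" if "i < n" for i
        using spoke[of i] True that by (cases "i = t") auto
      then show False
        using v by (metis eq_vecI carrier_vecD index_zero_vec)
    qed
    then show ?thesis ..
  qed simp
  then show "l \<in> {1, 1 - r, 1 + r}"
    by (auto simp: power2_eq_iff algebra_simps)
qed

lemma one_minus_L2_set_in_spectrum_arrowhead_mat:
  assumes "t < n"
  shows "1 - L2_set w ({..<n} - {t}) \<in> spectrum (arrowhead_mat n t 1 w)"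
proof -
  let ?r = "L2_set w ({..<n} - {t})"
  \<comment> \<open>If \<open>w\<close> vanishes, then so does \<open>w j / ?r\<close>, and the unit vector at \<open>t\<close> is an eigenvector.\<close>
  define v where "v = vec n (\<lambda>j. if j = t then 1 else - w j / ?r)"
  have "(\<Sum>j\<in>{..<n} - {t}. w j * v $ j) = - (\<Sum>j\<in>{..<n} - {t}. (w j)\<^sup>2) / ?r"
    by (simp add: v_def power2_eq_square sum_negf sum_divide_distrib)
  also have "\<dots> = - ?r\<^sup>2 / ?r"
    by (simp add: L2_set_def sum_nonneg)
  finally have hub: "(\<Sum>j\<in>{..<n} - {t}. w j * v $ j) = - ?r"
    by (simp add: power2_eq_square)
  have spoke: "w j + v $ j = (1 - ?r) * v $ j" if "j < n" "j \<noteq> t" for j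
  proof (cases "?r = 0")
    case True
    then show ?thesis
      using that by (simp add: v_def L2_set_eq_0_iff)
  next
    case False
    then show ?thesis
      using that by (simp add: v_def field_simps)
  qed
  have "arrowhead_mat n t 1 w *\<^sub>v v = (1 - ?r) \<cdot>\<^sub>v v"
  proof (rule eq_vecI)
    fix i assume "i < dim_vec ((1 - ?r) \<cdot>\<^sub>v v)"
    then have "i < n"
      by (simp add: v_def)
    then have "(arrowhead_mat n t 1 w *\<^sub>v v) $ i = (1 - ?r) * v $ i"
      using \<open>t < n\<close> hub spoke[of i]
      by (subst arrowhead_mat_mult_vec) (auto simp: v_def)
    then show "(arrowhead_mat n t 1 w *\<^sub>v v) $ i = ((1 - ?r) \<cdot>\<^sub>v v) $ i"
      using \<open>i < n\<close> by (simp add: v_def)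
  qed (simp add: v_def)
  moreover have "v \<noteq> 0\<^sub>v n"
    using \<open>t < n\<close> by (auto simp: v_def dest: arg_cong[of _ _ "\<lambda>u. u $ t"])
  ultimately show ?thesis
    by (auto simp: spectrum_def eigenvalue_def eigenvector_def v_def intro!: exI[of _ v])
qed

lemma spectral_gap_arrowhead_mat:
  fixes w :: "nat \<Rightarrow> real"
  assumes "t < n" and "0 < a" and "L2_set w ({..<n} - {t}) < sqrt a"
  shows "spectral_gap (arrowhead_mat n t a w) = (1 - L2_set w ({..<n} - {t}) / sqrt a) / 2"
proof -
  let ?B = "arrowhead_mat n t 1 (\<lambda>j. w j / sqrt a)"
  define r where "r = L2_set (\<lambda>j. w j / sqrt a) ({..<n} - {t})"
  have r: "r = L2_set w ({..<n} - {t}) / sqrt a"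
    using L2_set_left_distrib[of "1 / sqrt a" w] \<open>0 < a\<close> by (simp add: r_def)
  then have "0 \<le> r" "r < 1"
    using assms by simp_all
  have spectrum: "spectrum ?B \<subseteq> {1, 1 - r, 1 + r}" "1 - r \<in> spectrum ?B"
    using spectrum_arrowhead_mat_subset one_minus_L2_set_in_spectrum_arrowhead_mat \<open>t < n\<close>
    unfolding r_def by blast+
  have "Min (spectrum ?B - {0}) = 1 - r"
  proof (rule Min_eqI)
    show "finite (spectrum ?B - {0})"
      using spectrum(1) by (simp add: finite_subset)
  qed (use spectrum \<open>0 \<le> r\<close> \<open>r < 1\<close> in auto)
  then show ?thesis
    using \<open>0 < a\<close> by (simp add: spectral_gap_def normalized_arrowhead_mat r)
qed

lemma arrowhead_mat_in_sdd_inputs: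
  fixes w :: "nat \<Rightarrow> real"
  assumes "t < n" and "0 < a" and "(\<Sum>j\<in>{..<n} - {t}. \<bar>w j\<bar>) \<le> a"
    and "\<And>j. \<lbrakk>j < n; j \<noteq> t\<rbrakk> \<Longrightarrow> \<bar>w j\<bar> \<le> 1"
    and small: "L2_set w ({..<n} - {t}) < sqrt a"
    and gap: "\<gamma> \<le> (1 - L2_set w ({..<n} - {t}) / sqrt a) / 2"
  shows "arrowhead_mat n t a w \<in> sdd_inputs n \<gamma>"
proof -
  have "(\<Sum>j\<in>{..<n} - {t}. (w j)\<^sup>2) < a"
    using small by (simp add: L2_set_def)
  then have "invertible_mat (arrowhead_mat n t a w)"
    using \<open>t < n\<close> by (intro invertible_arrowhead_mat) auto
  moreover have "\<gamma> \<le> spectral_gap (arrowhead_mat n t a w)"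
    using gap spectral_gap_arrowhead_mat[OF assms(1,2) small] by simp
  ultimately show ?thesis
    using SDD_arrowhead_mat assms by (simp add: sdd_inputs_def)
qed

section \<open>Arrowhead matrices with a single link\<close>

definition linked_mat :: "nat \<Rightarrow> nat \<Rightarrow> nat \<Rightarrow> real \<Rightarrow> real \<Rightarrow> real mat" where
  "linked_mat n t k a d = arrowhead_mat n t a (\<lambda>j. if j = k then d else 0)"

definition ones_off :: "nat \<Rightarrow> nat \<Rightarrow> real vec" where
  "ones_off n t = vec n (\<lambda>i. if i = t then 0 else 1)"

lemma ones_off_carrier [simp]: "ones_off n t \<in> carrier_vec n"
  by (simp add: ones_off_def)

lemma ones_off_index [simp]: "i < n \<Longrightarrow> ones_off n t $ i = (if i = t then 0 else 1)"
  by (simp add: ones_off_def)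

lemma sum_single_link:
  fixes f :: "real \<Rightarrow> real"
  assumes "finite I" and "k \<in> I" and "f 0 = 0"
  shows "(\<Sum>j\<in>I. f (if j = k then d else 0)) = f d"
  using assms by (simp add: if_distrib[of f] cong: if_cong)

lemma linked_mat_in_sdd_inputs:
  assumes "t < n" "k < n" "k \<noteq> t" and "0 < a" "a < 1" and d: "\<bar>d\<bar> \<le> a"
  shows "linked_mat n t k a d \<in> sdd_inputs n ((1 - sqrt a) / 2)"
proof -
  let ?w = "\<lambda>j. if j = k then d else 0"
  have weight_sum: "(\<Sum>j\<in>{..<n} - {t}. \<bar>?w j\<bar>) = \<bar>d\<bar>"
    using assms sum_single_link[of "{..<n} - {t}" k abs] by simp
  have weight_norm: "L2_set ?w ({..<n} - {t}) = \<bar>d\<bar>"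
    using assms sum_single_link[of "{..<n} - {t}" k "\<lambda>x. x\<^sup>2"] by (simp add: L2_set_def)
  have "a < sqrt a"
    using assms by (simp add: real_less_rsqrt power2_eq_square)
  have "\<bar>d\<bar> / sqrt a \<le> sqrt a"
    using d \<open>0 < a\<close> by (simp add: divide_le_eq)
  then have "(1 - sqrt a) / 2 \<le> (1 - \<bar>d\<bar> / sqrt a) / 2"
    by (intro divide_right_mono diff_left_mono) simp_all
  with \<open>a < sqrt a\<close> show ?thesis
    unfolding linked_mat_def using assms
    by (intro arrowhead_mat_in_sdd_inputs) (auto simp: weight_sum weight_norm)
qed

lemma linear_solution_linked_mat:
  assumes "t < n" "k < n" "k \<noteq> t" and nonsingular: "d\<^sup>2 \<noteq> a"
  shows "linear_solution (linked_mat n t k a d) (ones_off n t)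
    = vec n (\<lambda>j. if j = t then - d / (a - d\<^sup>2) else if j = k then a / (a - d\<^sup>2) else 1)"
proof -
  define w where "w = (\<lambda>j. if j = k then d else 0)"
  have schur: "(\<Sum>j\<in>{..<n} - {t}. (w j)\<^sup>2) = d\<^sup>2"
    using assms sum_single_link[of "{..<n} - {t}" k "\<lambda>x. x\<^sup>2"] by (simp add: w_def)
  have "(\<Sum>j\<in>{..<n} - {t}. w j * ones_off n t $ j) = (\<Sum>j\<in>{..<n} - {t}. w j)"
    by (intro sum.cong) auto
  also have "\<dots> = d"
    using assms by (simp add: w_def)
  finally have weight_rhs: "(\<Sum>j\<in>{..<n} - {t}. w j * ones_off n t $ j) = d" .
  have "linear_solution (linked_mat n t k a d) (ones_off n t)
      = vec n (\<lambda>j. if j = t then (ones_off n t $ t - d) / (a - d\<^sup>2)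
          else ones_off n t $ j - w j * ((ones_off n t $ t - d) / (a - d\<^sup>2)))"
    using linear_solution_arrowhead_mat[OF \<open>t < n\<close> ones_off_carrier, of a w t] nonsingular
    unfolding linked_mat_def w_def[symmetric] schur weight_rhs by blast
  also have "\<dots> = vec n (\<lambda>j. if j = t then - d / (a - d\<^sup>2) else if j = k then a / (a - d\<^sup>2) else 1)"
    using assms by (intro eq_vecI) (auto simp: w_def field_simps power2_eq_square)
  finally show ?thesis .
qed

lemma linked_mat_extremal_solution:
  assumes "t < n" "k < n" "k \<noteq> t" and a: "0 < a" "a < 1" and d: "\<bar>d\<bar> = a"
  defines "x \<equiv> linear_solution (linked_mat n t k a d) (ones_off n t)"
  shows "x $ t = - d / (a * (1 - a))" and "linf_norm x = 1 / (1 - a)"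
proof -
  have schur: "a - d\<^sup>2 = a * (1 - a)"
    unfolding d[symmetric] by (simp add: algebra_simps flip: power2_eq_square)
  then have "d\<^sup>2 \<noteq> a"
    using a by auto
  then have x: "x = vec n (\<lambda>j.
      if j = t then - d / (a * (1 - a)) else if j = k then 1 / (1 - a) else 1)"
    using a linear_solution_linked_mat[OF assms(1-3)] by (simp add: x_def schur cong: if_cong)
  show "x $ t = - d / (a * (1 - a))"
    using \<open>t < n\<close> by (simp add: x)
  have "\<bar>x $ j\<bar> \<le> 1 / (1 - a)" if "j < n" for j
    using a d that by (simp add: x abs_mult)
  moreover have "\<bar>x $ k\<bar> = 1 / (1 - a)"
    using \<open>k < n\<close> \<open>k \<noteq> t\<close> a by (simp add: x)
  moreover have "dim_vec x = n"
    by (simp add: x)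
  ultimately show "linf_norm x = 1 / (1 - a)"
    unfolding linf_norm_def using \<open>k < n\<close> by (intro Max_eqI) force+
qed

lemma accurate_outputs_linked_mat_disjoint:
  assumes "t < n" "k < n" "k \<noteq> t" and "0 < a" "a < 1" and "\<epsilon> < 1"
  shows "accurate_outputs \<epsilon> (linked_mat n t k a a) (ones_off n t) t
    \<inter> accurate_outputs \<epsilon> (linked_mat n t k a (- a)) (ones_off n t) t = {}"
proof -
  define m where "m = 1 / (1 - a)"
  have "\<epsilon> * m < m"
    using assms mult_strict_right_mono[of \<epsilon> 1 m] by (simp add: m_def)
  then have "\<not> (\<bar>y + m\<bar> \<le> \<epsilon> * m \<and> \<bar>y - m\<bar> \<le> \<epsilon> * m)" for y
    by linarith
  then show ?thesis
    using assms by (auto simp: accurate_outputs_def linked_mat_extremal_solution m_def)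
qed

lemma diagonal_in_sdd_inputs:
  assumes "t < n" and "0 < a" "a < 1"
  shows "arrowhead_mat n t a (\<lambda>_. 0) \<in> sdd_inputs n ((1 - sqrt a) / 2)"
  using assms by (intro arrowhead_mat_in_sdd_inputs) (simp_all add: L2_set_def)

lemma expected_probes_of_diagonal_ge:
  fixes \<epsilon> p :: real
  assumes "t < n" and "0 < a" "a < 1" and "\<epsilon> < 1"
    and alg: "randomized_algorithm n R"
    and success: "\<And>S. S \<in> sdd_inputs n ((1 - sqrt a) / 2) \<Longrightarrow>
      p \<le> measure R {T \<in> space R. tree_output S T \<in> accurate_outputs \<epsilon> S (ones_off n t) t}"
  shows "(2 * p - 1) * (real n - 1)
    \<le> (\<integral>T. real (card (probed (arrowhead_mat n t a (\<lambda>_. 0)) T)) \<partial>R)"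
proof -
  let ?link = "\<lambda>k s. linked_mat n t k a (if s then a else - a)"
  interpret hidden_blocks n "arrowhead_mat n t a (\<lambda>_. 0)" "{..<n} - {t}"
    "\<lambda>k. {(t, k), (k, t)}" ?link "\<lambda>k s. accurate_outputs \<epsilon> (?link k s) (ones_off n t) t"
  proof
    show "disjoint_family_on (\<lambda>k. {(t, k), (k, t)}) ({..<n} - {t})"
      by (auto simp: disjoint_family_on_def)
    show "?link k s $$ (i, j) = arrowhead_mat n t a (\<lambda>_. 0) $$ (i, j)"
      if "i < n" "j < n" "(i, j) \<notin> {(t, k), (k, t)}" for k s i j
      using that by (auto simp: linked_mat_def arrowhead_mat_index)
    show "accurate_outputs \<epsilon> (?link k True) (ones_off n t) t
      \<inter> accurate_outputs \<epsilon> (?link k False) (ones_off n t) t = {}" if "k \<in> {..<n} - {t}" for k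
      using accurate_outputs_linked_mat_disjoint that assms by simp
  qed (simp_all add: linked_mat_def accurate_outputs_borel)
  have "real (card ({..<n} - {t})) = real n - 1"
    using \<open>t < n\<close> by (simp add: of_nat_diff)
  then show ?thesis
    using expected_probes_ge[OF alg, of p] success linked_mat_in_sdd_inputs assms by simp
qed

corollary many_probes_of_diagonal:
  fixes \<epsilon> p q :: real
  assumes "t < n" "0 < a" "a < 1" "\<epsilon> < 1" and q: "q \<le> (2 * p - 1) * (real n - 1)"
    and alg: "randomized_algorithm n R"
    and "\<And>S. S \<in> sdd_inputs n ((1 - sqrt a) / 2) \<Longrightarrow>
      p \<le> measure R {T \<in> space R. tree_output S T \<in> accurate_outputs \<epsilon> S (ones_off n t) t}"
  shows "0 < measure R {T \<in> space R. q \<le> real (card (probed (arrowhead_mat n t a (\<lambda>_. 0)) T))}"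
proof -
  interpret prob_space R
    using alg by (simp add: randomized_algorithm_def)
  show ?thesis
    using order_trans[OF q expected_probes_of_diagonal_ge] assms
    by (intro prob_ge_pos_if_expectation_ge integrable_card_probed[OF alg]) auto
qed

theorem theorem1p11:
  shows "\<exists>\<gamma>>0. \<forall>c>0. \<exists>c'>0. \<exists>n\<^sub>0. \<forall>n\<ge>n\<^sub>0. \<forall>\<epsilon>::real.
    c / real n \<le> \<epsilon> \<and> \<epsilon> < 1 \<longrightarrow>
    (\<exists>b\<in>carrier_vec n. \<exists>t<n. \<forall>R. randomized_algorithm n R \<longrightarrow>
      (\<forall>S\<in>sdd_inputs n \<gamma>.
         measure R {T \<in> space R.
           \<bar>tree_output S T - vec_index (linear_solution S b) t\<bar>
             \<le> \<epsilon> * linf_norm (linear_solution S b)} \<ge> 3 / 4) \<longrightarrow>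
      (\<exists>S\<in>sdd_inputs n \<gamma>.
         measure R {T \<in> space R. real (card (probed S T)) \<ge> c' / \<epsilon>} > 0))"
    (is "\<exists>\<gamma>>0. \<forall>c>0. \<exists>c'>0. \<exists>n\<^sub>0. \<forall>n\<ge>n\<^sub>0. \<forall>\<epsilon>. ?range c n \<epsilon> \<longrightarrow> ?hard \<gamma> c' n \<epsilon>")
proof (rule exI[of _ "1 / 4"], intro conjI allI impI)
  fix c :: real
  assume "0 < c"
  show "\<exists>c'>0. \<exists>n\<^sub>0. \<forall>n\<ge>n\<^sub>0. \<forall>\<epsilon>. ?range c n \<epsilon> \<longrightarrow> ?hard (1 / 4) c' n \<epsilon>"
  proof (intro exI[of _ "c / 4"] exI[of _ "2 :: nat"] conjI allI impI)
    fix n :: nat and \<epsilon> :: real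
    assume n: "2 \<le> n" and \<epsilon>: "?range c n \<epsilon>"
    have gap: "(1 - sqrt (1 / 4)) / 2 = (1 / 4 :: real)"
      by (simp add: real_sqrt_divide)
    have "0 < c / real n"
      using \<open>0 < c\<close> n by simp
    then have "0 < \<epsilon>"
      using \<epsilon> by linarith
    then have "c / 4 / \<epsilon> \<le> real n / 4"
      using \<epsilon> n by (simp add: field_simps)
    also have "\<dots> \<le> (2 * (3 / 4) - 1) * (real n - 1)"
      using n by simp
    finally show "?hard (1 / 4) (c / 4) n \<epsilon>"
      using many_probes_of_diagonal[of 0 n "1 / 4" \<epsilon> "c / 4 / \<epsilon>" "3 / 4"] \<epsilon> n
        diagonal_in_sdd_inputs[of 0 n "1 / 4"]
      unfolding gap accurate_outputs_def mem_Collect_eq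
      by (intro bexI[of _ "ones_off n 0"] exI[of _ "0 :: nat"] conjI allI impI) auto
  qed (use \<open>0 < c\<close> in simp)
qed simp

end
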